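(* Consider the following three latin squares of order $10$, with entries in $\{0,1,\dots,9\}$: $$A=\left[\begin{array}{cccccccccc} 0&8&9&7&5&6&4&2&3&1\\ 9&1&4&6&2&7&3&8&0&5\\ 7&4&2&5&1&3&8&6&9&0\\ 8&6&5&3&9&2&1&0&4&7\\ 6&2&1&8&4&0&9&5&7&3\\ 4&9&3&2&7&5&0&1&6&8\\ 5&3&7&1&0&8&6&9&2&4\\ 3&5&0&9&8&4&2&7&1&6\\ 1&7&6&0&3&9&5&4&8&2\\ 2&0&8&4&6&1&7&3&5&9 \end{array}\right],$$ $$B=\left[\begin{array}{cccccccccc} 0&7&8&9&1&2&3&4&5&6\\ 9&0&6&1&8&3&2&5&4&7\\ 7&2&0&4&3&9&1&8&6&5\\ 8&5&3&0&2&1&7&6&9&4\\ 6&9&5&3&0&7&4&2&1&8\\ 4&1&7&6&5&0&8&9&3&2\\ 5&4&2&8&9&6&0&3&7&1\\ 3&6&1&7&4&8&5&0&2&9\\ 1&8&4&2&6&5&9&7&0&3\\ 2&3&9&5&7&4&6&1&8&0 \end{array}\right],$$ $$C=\left[\begin{array}{cccccccccc} 0&7&8&9&1&2&3&4&5&6\\ 6&4&2&8&9&5&1&3&7&0\\ 4&9&5&3&2&7&6&0&1&8\\ 5&1&7&6&4&3&8&9&0&2\\ 3&2&9&0&7&1&5&6&8&4\\ 1&0&3&7&6&8&2&5&4&9\\ 2&8&0&1&3&4&9&7&6&5\\ 9&5&4&2&8&6&0&1&3&7\\ 7&3&6&5&0&9&4&8&2&1\\ 8&6&1&4&5&0&7&2&9&3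 \end{array}\right].$$ Square $A$ is orthogonal to both $B$ and $C$. When $B$ and $C$ are overlaid, $91$ different ordered pairs $(B[r,c],C[r,c])$ are produced out of a possible $100$. Moreover, the only duplicated pairs (those produced by more than one cell) involve the symbols $7,8,9$ in $C$. Consequently, $A$ and $B$ have $7$ common transversals.
   Context: A latin square of order $n$ is an $n\times n$ matrix on $n$ symbols in which each symbol occurs exactly once in each row and each column; $L[r,c]$ denotes the entry of $L$ in row $r$ and column $c$. Two latin squares of order $n$ are orthogonal if overlaying them produces $n^2$ distinct ordered pairs of symbols. A common transversal of a pair of orthogonal latin squares of order $n$ is a selection of $n$ cells, one from each row and one from each column, such that in each of the two squares the entries in the selected cells are all different. *)

theory Defs
  imports "Jordan_Normal_Form.Matrix"
begin

text \<open>Rows and columns are indexed from 0, as usual for the type of matrices.\<close>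

definition cells :: "nat \<Rightarrow> (nat \<times> nat) set" where
  "cells n = {..<n} \<times> {..<n}"

definition latin_square :: "nat \<Rightarrow> 'a set \<Rightarrow> 'a mat \<Rightarrow> bool" where
  "latin_square n S L \<longleftrightarrow>
     L \<in> carrier_mat n n \<and> finite S \<and> card S = n \<and> elements_mat L \<subseteq> S \<and>
     (\<forall>s\<in>S. (\<forall>r<n. \<exists>!c. c < n \<and> L $$ (r, c) = s) \<and>
            (\<forall>c<n. \<exists>!r. r < n \<and> L $$ (r, c) = s))"

definition overlay :: "'a mat \<Rightarrow> 'b mat \<Rightarrow> nat \<times> nat \<Rightarrow> 'a \<times> 'b" where
  "overlay X Y p = (X $$ p, Y $$ p)"

definition orthogonal_squares :: "nat \<Rightarrow> 'a mat \<Rightarrow> 'b mat \<Rightarrow> bool" where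
  "orthogonal_squares n X Y \<longleftrightarrow> card (overlay X Y ` cells n) = n\<^sup>2"

definition duplicated_pairs :: "nat \<Rightarrow> 'a mat \<Rightarrow> 'b mat \<Rightarrow> ('a \<times> 'b) set" where
  "duplicated_pairs n X Y =
     {q. \<exists>p\<in>cells n. \<exists>p'\<in>cells n. p \<noteq> p' \<and> overlay X Y p = q \<and> overlay X Y p' = q}"

definition common_transversal ::
  "nat \<Rightarrow> 'a mat \<Rightarrow> 'b mat \<Rightarrow> (nat \<times> nat) set \<Rightarrow> bool" where
  "common_transversal n X Y T \<longleftrightarrow>
     T \<subseteq> cells n \<and> card T = n \<and>
     bij_betw fst T {..<n} \<and> bij_betw snd T {..<n} \<and>
     inj_on (\<lambda>p. X $$ p) T \<and> inj_on (\<lambda>p. Y $$ p) T"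

definition square_A :: "nat mat" where
  "square_A = mat_of_rows_list 10
  [[0, 8, 9, 7, 5, 6, 4, 2, 3, 1],
   [9, 1, 4, 6, 2, 7, 3, 8, 0, 5],
   [7, 4, 2, 5, 1, 3, 8, 6, 9, 0],
   [8, 6, 5, 3, 9, 2, 1, 0, 4, 7],
   [6, 2, 1, 8, 4, 0, 9, 5, 7, 3],
   [4, 9, 3, 2, 7, 5, 0, 1, 6, 8],
   [5, 3, 7, 1, 0, 8, 6, 9, 2, 4],
   [3, 5, 0, 9, 8, 4, 2, 7, 1, 6],
   [1, 7, 6, 0, 3, 9, 5, 4, 8, 2],
   [2, 0, 8, 4, 6, 1, 7, 3, 5, 9]]"

definition square_B :: "nat mat" where
  "square_B = mat_of_rows_list 10
  [[0, 7, 8, 9, 1, 2, 3, 4, 5, 6],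
   [9, 0, 6, 1, 8, 3, 2, 5, 4, 7],
   [7, 2, 0, 4, 3, 9, 1, 8, 6, 5],
   [8, 5, 3, 0, 2, 1, 7, 6, 9, 4],
   [6, 9, 5, 3, 0, 7, 4, 2, 1, 8],
   [4, 1, 7, 6, 5, 0, 8, 9, 3, 2],
   [5, 4, 2, 8, 9, 6, 0, 3, 7, 1],
   [3, 6, 1, 7, 4, 8, 5, 0, 2, 9],
   [1, 8, 4, 2, 6, 5, 9, 7, 0, 3],
   [2, 3, 9, 5, 7, 4, 6, 1, 8, 0]]"

definition square_C :: "nat mat" where
  "square_C = mat_of_rows_list 10
  [[0, 7, 8, 9, 1, 2, 3, 4, 5, 6],
   [6, 4, 2, 8, 9, 5, 1, 3, 7, 0],
   [4, 9, 5, 3, 2, 7, 6, 0, 1, 8],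
   [5, 1, 7, 6, 4, 3, 8, 9, 0, 2],
   [3, 2, 9, 0, 7, 1, 5, 6, 8, 4],
   [1, 0, 3, 7, 6, 8, 2, 5, 4, 9],
   [2, 8, 0, 1, 3, 4, 9, 7, 6, 5],
   [9, 5, 4, 2, 8, 6, 0, 1, 3, 7],
   [7, 3, 6, 5, 0, 9, 4, 8, 2, 1],
   [8, 6, 1, 4, 5, 0, 7, 2, 9, 3]]"

end

theory Submission
  imports Defs
begin

text \<open>If \<open>Z\<close> is a latin square, the cells containing a fixed symbol \<open>s\<close> of \<open>Z\<close> meet every row
  and every column once. A square orthogonal to \<open>Z\<close> has distinct entries in these cells, and so has
  every square \<open>Y\<close> for which no repeated pair of the overlay of \<open>Y\<close> and \<open>Z\<close> involves \<open>s\<close>. Hence the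
  seven symbols of \<open>C\<close> other than \<open>7, 8, 9\<close> yield seven common transversals of \<open>A\<close> and \<open>B\<close>.\<close>

section \<open>Common transversals from the symbols of a third square\<close>

lemma finite_cells [simp]: "finite (cells n)"
  by (simp add: cells_def)

text \<open>There are \<open>n\<^sup>2\<close> cells, so the image of the overlay has full size
  exactly when no two cells collide.\<close>

lemma orthogonal_squares_iff_inj:
  "orthogonal_squares n X Y \<longleftrightarrow> inj_on (overlay X Y) (cells n)"
proof -
  have "card (cells n) = n\<^sup>2"
    by (simp add: cells_def power2_eq_square)
  then show ?thesis
    unfolding orthogonal_squares_def using inj_on_iff_eq_card[OF finite_cells] by metis
qed

lemma inj_on_symbol_cells:
  assumes "s \<notin> snd ` duplicated_pairs n X Z"
  shows "inj_on (\<lambda>p. X $$ p) {p \<in> cells n. Z $$ p = s}"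
proof (rule inj_onI, rule ccontr)
  fix p q
  assume pq: "p \<in> {p \<in> cells n. Z $$ p = s}" "q \<in> {p \<in> cells n. Z $$ p = s}"
    "X $$ p = X $$ q" "p \<noteq> q"
  then have "(X $$ p, s) \<in> duplicated_pairs n X Z"
    by (auto simp: duplicated_pairs_def overlay_def)
  then show False
    using assms by force
qed

lemma orthogonal_imp_no_duplicated_pairs:
  assumes "orthogonal_squares n X Y"
  shows "duplicated_pairs n X Y = {}"
proof -
  have "inj_on (overlay X Y) (cells n)"
    using assms by (simp add: orthogonal_squares_iff_inj)
  then show ?thesis
    unfolding duplicated_pairs_def by (blast dest: inj_onD)
qed

text \<open>Uniqueness of the cell with symbol \<open>s\<close> in each row makes \<open>fst\<close>
  injective, existence makes it surjective; columns do the same for \<open>snd\<close>.\<close>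

lemma latin_square_symbol_cells:
  assumes "latin_square n S Z" "s \<in> S"
  shows "bij_betw fst {p \<in> cells n. Z $$ p = s} {..<n}"
    and "bij_betw snd {p \<in> cells n. Z $$ p = s} {..<n}"
proof -
  have row: "\<exists>!c. c < n \<and> Z $$ (r, c) = s" if "r < n" for r
    using assms that by (simp add: latin_square_def)
  have col: "\<exists>!r. r < n \<and> Z $$ (r, c) = s" if "c < n" for c
    using assms that by (simp add: latin_square_def)
  have "inj_on fst {p \<in> cells n. Z $$ p = s}"
    by (rule inj_onI) (clarsimp simp: cells_def, metis row)
  moreover have "fst ` {p \<in> cells n. Z $$ p = s} = {..<n}"
  proof (intro equalityI subsetI)
    fix r assume "r \<in> {..<n}"
    then obtain c where "(r, c) \<in> {p \<in> cells n. Z $$ p = s}"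
      using row[of r] by (auto simp: cells_def)
    then show "r \<in> fst ` {p \<in> cells n. Z $$ p = s}"
      by force
  qed (auto simp: cells_def)
  ultimately show "bij_betw fst {p \<in> cells n. Z $$ p = s} {..<n}"
    by (simp add: bij_betw_def)
  have "inj_on snd {p \<in> cells n. Z $$ p = s}"
    by (rule inj_onI) (clarsimp simp: cells_def, metis col)
  moreover have "snd ` {p \<in> cells n. Z $$ p = s} = {..<n}"
  proof (intro equalityI subsetI)
    fix c assume "c \<in> {..<n}"
    then obtain r where "(r, c) \<in> {p \<in> cells n. Z $$ p = s}"
      using col[of c] by (auto simp: cells_def)
    then show "c \<in> snd ` {p \<in> cells n. Z $$ p = s}"
      by force
  qed (auto simp: cells_def)
  ultimately show "bij_betw snd {p \<in> cells n. Z $$ p = s} {..<n}"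
    by (simp add: bij_betw_def)
qed

lemma common_transversal_symbol_cells:
  assumes "latin_square n S Z" "s \<in> S"
    and "s \<notin> snd ` duplicated_pairs n X Z" "s \<notin> snd ` duplicated_pairs n Y Z"
  shows "common_transversal n X Y {p \<in> cells n. Z $$ p = s}"
  using latin_square_symbol_cells[OF assms(1,2)] assms(3,4)[THEN inj_on_symbol_cells]
  by (auto simp: common_transversal_def dest: bij_betw_same_card)

lemma card_common_transversals_ge:
  assumes Z: "latin_square n S Z" and orth: "orthogonal_squares n X Z"
  shows "card (S - snd ` duplicated_pairs n Y Z) \<le> card {T. common_transversal n X Y T}"
proof -
  define T where "T s = {p \<in> cells n. Z $$ p = s}" for s
  \<comment> \<open>Sets \<open>T s\<close> for different symbols are disjoint; they could coincide
    only if both were empty.\<close>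
  have "T s \<noteq> {}" if "s \<in> S" for s
  proof -
    have "0 < n"
      using Z that by (auto simp: latin_square_def card_gt_0_iff)
    then show ?thesis
      using bij_betw_same_card[OF latin_square_symbol_cells(1)[OF Z that]]
      by (metis T_def card.empty card_lessThan less_irrefl)
  qed
  then have "inj_on T (S - snd ` duplicated_pairs n Y Z)"
    by (fastforce simp: inj_on_def T_def)
  moreover have "T ` (S - snd ` duplicated_pairs n Y Z) \<subseteq> {T. common_transversal n X Y T}"
    by (auto simp: T_def orthogonal_imp_no_duplicated_pairs[OF orth]
        intro!: common_transversal_symbol_cells[OF Z])
  \<comment> \<open>Finiteness matters: \<open>card\<close> of an infinite set is 0, which would
    spoil the lower bound.\<close>
  moreover have "{T. common_transversal n X Y T} \<subseteq> Pow (cells n)"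
    by (auto simp: common_transversal_def)
  then have "finite {T. common_transversal n X Y T}"
    by (rule finite_subset) simp
  ultimately show ?thesis
    by (rule card_inj_on_le)
qed

section \<open>Certifying a latin square from its list of rows\<close>

lemma ex1_nth_eq:
  assumes "distinct xs" "x \<in> set xs"
  shows "\<exists>!i. i < length xs \<and> xs ! i = x"
  using assms by (metis in_set_conv_nth nth_eq_iff_index_eq)

lemma set_eq_if_distinct_subset:
  assumes "distinct xs" "set xs \<subseteq> S" "finite S" "card S = length xs"
  shows "set xs = S"
  using assms by (simp add: card_subset_eq distinct_card)

text \<open>Testing distinctness and the range of symbols suffices: a list of \<open>n\<close>
  distinct elements of an \<open>n\<close>-element set \<open>S\<close> exhausts \<open>S\<close>,
  so each symbol has exactly one position. Quantifying \<open>c\<close> over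
  \<open>set [0..<n]\<close> lets the simplifier expand the column condition into finitely many
  checks.\<close>

lemma latin_square_mat_of_rows_list:
  assumes S: "finite S" "card S = n" and len: "length rs = n"
    and rows: "\<forall>row\<in>set rs. length row = n \<and> distinct row \<and> set row \<subseteq> S"
    and cols: "\<forall>c\<in>set [0..<n]. distinct (map (\<lambda>row. row ! c) rs)"
  shows "latin_square n S (mat_of_rows_list n rs)"
proof -
  have "elements_mat (mat_of_rows_list n rs) \<subseteq> S"
  proof
    fix x assume "x \<in> elements_mat (mat_of_rows_list n rs)"
    then obtain r c where "r < n" "c < n" "x = rs ! r ! c"
      using len by (auto simp: elements_mat_def mat_of_rows_list_def)
    then show "x \<in> S"
      using rows len by (metis nth_mem subsetD)
  qed
  moreover have "\<exists>!c. c < n \<and> mat_of_rows_list n rs $$ (r, c) = s" if "r < n" "s \<in> S" for r s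
  proof -
    have "rs ! r \<in> set rs"
      using that len by simp
    then have "\<exists>!c. c < n \<and> rs ! r ! c = s"
      using rows S that ex1_nth_eq[of "rs ! r" s] set_eq_if_distinct_subset[of "rs ! r" S] by auto
    then show ?thesis
      using that len by (simp add: mat_of_rows_list_def cong: conj_cong)
  qed
  moreover have "\<exists>!r. r < n \<and> mat_of_rows_list n rs $$ (r, c) = s" if "c < n" "s \<in> S" for c s
  proof -
    let ?col = "map (\<lambda>row. row ! c) rs"
    have "distinct ?col"
      using cols that by simp
    moreover have "set ?col \<subseteq> S"
      using rows that by (auto intro: subsetD[OF _ nth_mem])
    ultimately have "\<exists>!r. r < n \<and> ?col ! r = s"
      using S len that ex1_nth_eq[of ?col s] set_eq_if_distinct_subset[of ?col S] by auto
    then show ?thesis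
      using that len by (simp add: mat_of_rows_list_def cong: conj_cong)
  qed
  ultimately show ?thesis
    using S len by (simp add: latin_square_def mat_of_rows_list_def)
qed

section \<open>Overlays as lists of pairs\<close>

lemma map_entries_mat_of_rows_list:
  assumes "length rs = m" "\<forall>row\<in>set rs. length row = n"
  shows "map (($$) (mat_of_rows_list n rs)) (List.product [0..<m] [0..<n]) = concat rs"
proof -
  have "map (\<lambda>r. map (\<lambda>c. mat_of_rows_list n rs $$ (r, c)) [0..<n]) [0..<m] = rs"
    using assms by (intro nth_equalityI) (auto simp: mat_of_rows_list_def intro!: nth_equalityI)
  then show ?thesis
    by (simp add: product_concat_map map_concat comp_def)
qed

locale square_rows =
  fixes n :: nat and xs :: "'a list list" and ys :: "'b list list"
  assumes length_rows: "length xs = n" "\<forall>row\<in>set xs. length row = n"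
    "length ys = n" "\<forall>row\<in>set ys. length row = n"
begin

abbreviation "X \<equiv> mat_of_rows_list n xs"
abbreviation "Y \<equiv> mat_of_rows_list n ys"

text \<open>The overlay read in row-major order, the order in which \<open>List.product\<close>
  enumerates the cells. Claims about overlays thereby become computations on explicit lists.\<close>

definition pairs :: "('a \<times> 'b) list" where
  "pairs = zip (concat xs) (concat ys)"

definition cell_list :: "(nat \<times> nat) list" where
  "cell_list = List.product [0..<n] [0..<n]"

lemma cell_list: "distinct cell_list" "set cell_list = cells n"
  by (auto simp: cell_list_def cells_def distinct_product)

lemma map_overlay: "map (overlay X Y) cell_list = pairs"
proof -
  have "pairs = zip (map (($$) X) cell_list) (map (($$) Y) cell_list)"
    using length_rows by (simp add: pairs_def cell_list_def map_entries_mat_of_rows_list)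
  then show ?thesis
    by (simp add: zip_map_map zip_same_conv_map overlay_def)
qed

lemma overlay_image_cells: "overlay X Y ` cells n = set pairs"
  by (metis cell_list(2) list.set_map map_overlay)

lemma orthogonal_squares_if_distinct:
  assumes "distinct pairs"
  shows "orthogonal_squares n X Y"
  using assms unfolding orthogonal_squares_iff_inj
  by (metis cell_list(2) distinct_map map_overlay)

lemma card_overlay: "card (overlay X Y ` cells n) = length (remdups pairs)"
  by (simp add: overlay_image_cells length_remdups_card_conv)

text \<open>Filtering by the second component keeps or drops all copies of a pair together. Hence a
  duplicated pair with second component outside \<open>D\<close> would still be repeated after
  filtering.\<close>

lemma duplicated_symbols_subset:
  assumes "distinct (filter (\<lambda>q. snd q \<notin> D) pairs)"
  shows "snd ` duplicated_pairs n X Y \<subseteq> D"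
proof -
  have "distinct (map (overlay X Y) (filter (\<lambda>p. snd (overlay X Y p) \<notin> D) cell_list))"
    using assms by (simp add: map_overlay[symmetric] filter_map comp_def)
  then have inj: "inj_on (overlay X Y) {p \<in> cells n. snd (overlay X Y p) \<notin> D}"
    by (simp add: distinct_map cell_list)
  have "snd q \<in> D" if "q \<in> duplicated_pairs n X Y" for q
    using that inj_onD[OF inj] unfolding duplicated_pairs_def mem_Collect_eq by metis
  then show ?thesis
    by blast
qed

end

section \<open>Computations with the squares A, B and C\<close>

lemma upt_0_10: "[0..<10] = [0, 1, 2, 3, 4, 5, 6, 7, 8, 9]"
  by (simp add: upt_rec)

lemma latin_A: "latin_square 10 {0..9} square_A"
  unfolding square_A_def
  by (rule latin_square_mat_of_rows_list) (simp_all add: upt_0_10)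

lemma latin_B: "latin_square 10 {0..9} square_B"
  unfolding square_B_def
  by (rule latin_square_mat_of_rows_list) (simp_all add: upt_0_10)

lemma latin_C: "latin_square 10 {0..9} square_C"
  unfolding square_C_def
  by (rule latin_square_mat_of_rows_list) (simp_all add: upt_0_10)

lemma orth_AB: "orthogonal_squares 10 square_A square_B"
  unfolding square_A_def square_B_def
  by (rule square_rows.orthogonal_squares_if_distinct)
    (simp_all add: square_rows_def square_rows.pairs_def)

lemma orth_AC: "orthogonal_squares 10 square_A square_C"
  unfolding square_A_def square_C_def
  by (rule square_rows.orthogonal_squares_if_distinct)
    (simp_all add: square_rows_def square_rows.pairs_def)

lemma card_overlay_BC: "card (overlay square_B square_C ` cells 10) = 91"
  unfolding square_B_def square_C_def
  by (subst square_rows.card_overlay) (simp_all add: square_rows_def square_rows.pairs_def)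

lemmas square_entries = mat_of_rows_list_def square_B_def square_C_def

lemma duplicated_symbols_BC: "snd ` duplicated_pairs 10 square_B square_C = {7, 8, 9}"
proof
  show "snd ` duplicated_pairs 10 square_B square_C \<subseteq> {7, 8, 9}"
    unfolding square_B_def square_C_def
    by (rule square_rows.duplicated_symbols_subset)
      (simp_all add: square_rows_def square_rows.pairs_def)
next
  have dup: "s \<in> snd ` duplicated_pairs 10 square_B square_C"
    if "p \<in> cells 10" "q \<in> cells 10" "p \<noteq> q"
      "square_B $$ p = square_B $$ q" "square_C $$ p = s" "square_C $$ q = s" for p q s
    using that by (force simp: duplicated_pairs_def overlay_def)
  \<comment> \<open>For the reverse inclusion, the cells below exhibit one repeated pair for each
    symbol: (9, 7), (1, 8) and (2, 9).\<close>
  have "7 \<in> snd ` duplicated_pairs 10 square_B square_C"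
    by (rule dup[of "(2, 5)" "(7, 9)"]) (simp_all add: square_entries cells_def)
  moreover have "8 \<in> snd ` duplicated_pairs 10 square_B square_C"
    by (rule dup[of "(1, 3)" "(4, 8)"]) (simp_all add: square_entries cells_def)
  moreover have "9 \<in> snd ` duplicated_pairs 10 square_B square_C"
    by (rule dup[of "(2, 1)" "(5, 9)"]) (simp_all add: square_entries cells_def)
  ultimately show "{7, 8, 9} \<subseteq> snd ` duplicated_pairs 10 square_B square_C"
    by simp
qed

theorem mainTheorem4:
  shows "latin_square 10 {0..9} square_A \<and> latin_square 10 {0..9} square_B \<and>
         latin_square 10 {0..9} square_C \<and>
         orthogonal_squares 10 square_A square_B \<and> orthogonal_squares 10 square_A square_C \<and>
         card (overlay square_B square_C ` cells 10) = 91 \<and>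
         snd ` duplicated_pairs 10 square_B square_C = {7, 8, 9} \<and>
         card {T. common_transversal 10 square_A square_B T} \<ge> 7"
proof -
  \<comment> \<open>The symbols 0 to 6 of \<open>square_C\<close> remain, each giving its own
    transversal.\<close>
  have "card ({0..9} - {7, 8, 9 :: nat}) = 7"
    by (subst card_Diff_subset) auto
  then have "card {T. common_transversal 10 square_A square_B T} \<ge> 7"
    using card_common_transversals_ge[OF latin_C orth_AC, of square_B]
    by (simp add: duplicated_symbols_BC)
  then show ?thesis
    using latin_A latin_B latin_C orth_AB orth_AC card_overlay_BC duplicated_symbols_BC by blast
qed

end
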